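(* Let $d,\alpha>1$, let $k\le n$ be integers, and fix a constant $\beta\ge1$. There is a random linear map $G:\mathbb{R}^d\to\mathbb{R}^t$ with $t=O(\tfrac{d}{\alpha}+\log k)$ (hidden constant may depend on $\beta$) such that for every set $P=\{p_1,\dots,p_n\}\subset\mathbb{R}^d$, with probability at least $2/3$, the following holds simultaneously for all assignment constraints $\mathrm{AC}:[k]^n\to\{0,1\}$: (1) $\mathrm{OPT}_{\mathrm{AC}}(G(P))\in[\mathrm{OPT}_{\mathrm{AC}}(P),\,O(\alpha)\cdot\mathrm{OPT}_{\mathrm{AC}}(P)]$; and (2) every feasible partition of $P$ into $k$ clusters is an $O(\alpha)$-approximate solution of $k$-center with assignment constraint $\mathrm{AC}$ for $P$ whenever the corresponding partition of $G(P)$ is a $\beta$-approximate solution of $k$-center with assignment constraint $\mathrm{AC}$ for $G(P)$.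
   Context: All sets of points are multisets indexed by $[n]$; $G(P)=(Gp_1,\dots,Gp_n)$, and a partition of $P$ into clusters indexed by $[k]$ corresponds to the partition of $G(P)$ with the same indices. An assignment is a map $\pi:[n]\to[k]$; an assignment constraint is a function $\mathrm{AC}:[k]^n\to\{0,1\}$, and $\pi$ is feasible if $\mathrm{AC}(\pi)=1$. A partition of $X=(x_1,\dots,x_n)$ into $k$ clusters $\pi^{-1}(1),\dots,\pi^{-1}(k)$ is feasible if $\pi$ is. The radius of a finite multiset $Y\subset\mathbb{R}^m$ is $\min_{c\in\mathbb{R}^m}\max_{y\in Y}\|y-c\|$ (Euclidean). In $k$-center with assignment constraint $\mathrm{AC}$, the goal is a feasible partition into $k$ clusters minimizing the maximum cluster radius; the minimum is $\mathrm{OPT}_{\mathrm{AC}}(X)$. A feasible partition is $\gamma$-approximate if its maximum cluster radius is at most $\gamma\,\mathrm{OPT}_{\mathrm{AC}}(X)$.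
   Formalization: The bound on t is read as t = O(max(1, d/α + log k)): for k = 1 and α much larger than d, the literal bound would force t = 0, for which OPT(G(P)) ≥ OPT(P) fails; k ≥ 1 is assumed. *)

theory Defs
  imports "HOL-Probability.Probability"
begin

text \<open>Points of R^m are represented as functions nat => real; only the coordinates
  0..<m are relevant. Point sets are indexed by {..<n}, clusters by {..<k}.\<close>

definition eucl_norm :: "nat \<Rightarrow> (nat \<Rightarrow> real) \<Rightarrow> real" where
  "eucl_norm m x = sqrt (\<Sum>i<m. (x i)^2)"

definition cluster_radius :: "nat \<Rightarrow> (nat \<Rightarrow> nat \<Rightarrow> real) \<Rightarrow> nat set \<Rightarrow> real" where
  "cluster_radius m X S =
     (if S = {} then 0 else (INF c. Max ((\<lambda>i. eucl_norm m (X i - c)) ` S)))"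

definition assignments :: "nat \<Rightarrow> nat \<Rightarrow> (nat \<Rightarrow> nat) set" where
  "assignments n k = {..<n} \<rightarrow>\<^sub>E {..<k}"

definition feasible :: "((nat \<Rightarrow> nat) \<Rightarrow> bool) \<Rightarrow> nat \<Rightarrow> nat \<Rightarrow> (nat \<Rightarrow> nat) \<Rightarrow> bool" where
  "feasible AC n k \<pi> \<longleftrightarrow> \<pi> \<in> assignments n k \<and> AC \<pi>"

definition max_radius :: "nat \<Rightarrow> nat \<Rightarrow> nat \<Rightarrow> (nat \<Rightarrow> nat \<Rightarrow> real) \<Rightarrow> (nat \<Rightarrow> nat) \<Rightarrow> real" where
  "max_radius m n k X \<pi> = Max ((\<lambda>j. cluster_radius m X {i. i < n \<and> \<pi> i = j}) ` {..<k})"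

definition OPT :: "nat \<Rightarrow> nat \<Rightarrow> nat \<Rightarrow> ((nat \<Rightarrow> nat) \<Rightarrow> bool) \<Rightarrow> (nat \<Rightarrow> nat \<Rightarrow> real) \<Rightarrow> real" where
  "OPT m n k AC X = Min (max_radius m n k X ` {\<pi>. feasible AC n k \<pi>})"

definition approx_sol :: "real \<Rightarrow> nat \<Rightarrow> nat \<Rightarrow> nat \<Rightarrow> ((nat \<Rightarrow> nat) \<Rightarrow> bool)
    \<Rightarrow> (nat \<Rightarrow> nat \<Rightarrow> real) \<Rightarrow> (nat \<Rightarrow> nat) \<Rightarrow> bool" where
  "approx_sol \<gamma> m n k AC X \<pi> \<longleftrightarrow> feasible AC n k \<pi> \<and> max_radius m n k X \<pi> \<le> \<gamma> * OPT m n k AC X"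

definition lin_apply :: "nat \<Rightarrow> nat \<Rightarrow> (nat \<Rightarrow> nat \<Rightarrow> real) \<Rightarrow> (nat \<Rightarrow> real) \<Rightarrow> (nat \<Rightarrow> real)" where
  "lin_apply t d G x = (\<lambda>i. if i < t then (\<Sum>j<d. G i j * x j) else 0)"

definition map_points :: "nat \<Rightarrow> nat \<Rightarrow> (nat \<Rightarrow> nat \<Rightarrow> real) \<Rightarrow> (nat \<Rightarrow> nat \<Rightarrow> real) \<Rightarrow> (nat \<Rightarrow> nat \<Rightarrow> real)" where
  "map_points t d G P = (\<lambda>i. lin_apply t d G (P i))"

end

theory Submission
  imports Defs
begin

text \<open>The map is a multiple of a uniformly random sign matrix with \<open>t \<approx> d / \<alpha> + ln k\<close> rows. With
  high probability its operator norm is \<open>O(\<surd>(d + t))\<close> (union bound over nets), while the norms of any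
  \<open>(k + 1)\<^sup>2\<close> prescribed vectors shrink at most to \<open>\<Omega>(\<surd>t)\<close> times their value (fourth moments), so the
  two bounds are a factor \<open>O(\<surd>\<alpha>)\<close> apart. The prescribed vectors are the differences of \<open>k + 1\<close>
  farthest-first points of \<open>P\<close>: two of these lie in the same cluster of any partition, and all of \<open>P\<close> is
  covered by balls around them, which bounds the contraction of the maximum cluster radius of every
  partition at the cost of one further factor \<open>O(\<surd>\<alpha>)\<close>. Maximum radii are therefore
  preserved up to \<open>O(\<alpha>)\<close> for all partitions simultaneously, hence under every constraint.\<close>

subsection \<open>Euclidean norm and linear maps\<close>


lemma eucl_norm_L2: "eucl_norm m x = L2_set x {..<m}"
  by (simp add: eucl_norm_def L2_set_def)

lemma eucl_norm_nonneg [simp]: "0 \<le> eucl_norm m x"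
  by (simp add: eucl_norm_L2)

lemma eucl_norm_sq: "(eucl_norm m x)\<^sup>2 = (\<Sum>i<m. (x i)\<^sup>2)"
  by (simp add: eucl_norm_def sum_nonneg)

lemma eucl_norm_scale: "eucl_norm m (\<lambda>i. c * x i) = \<bar>c\<bar> * eucl_norm m x"
  by (simp add: eucl_norm_def power_mult_distrib flip: sum_distrib_left)
     (simp add: real_sqrt_mult)

lemma eucl_norm_triangle: "eucl_norm m (\<lambda>i. x i + y i) \<le> eucl_norm m x + eucl_norm m y"
  unfolding eucl_norm_L2 by (rule L2_set_triangle_ineq)

lemma eucl_norm_diff_triangle:
  "eucl_norm m (x - z) \<le> eucl_norm m (x - y) + eucl_norm m (y - z)"
  using eucl_norm_triangle[of m "x - y" "y - z"] by (simp add: fun_diff_def)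

lemma eucl_norm_diff_commute: "eucl_norm m (x - y) = eucl_norm m (y - x)"
  by (simp add: eucl_norm_def power2_commute)

lemma inner_le_eucl_norm: "(\<Sum>i<m. x i * y i) \<le> eucl_norm m x * eucl_norm m y"
proof -
  have "(\<Sum>i<m. x i * y i) \<le> (\<Sum>i<m. \<bar>x i\<bar> * \<bar>y i\<bar>)"
    by (intro sum_mono) (metis abs_ge_self abs_mult)
  also have "\<dots> \<le> eucl_norm m x * eucl_norm m y"
    unfolding eucl_norm_L2 by (rule L2_set_mult_ineq)
  finally show ?thesis .
qed

lemma inner_self: "(\<Sum>i<m. x i * x i) = (eucl_norm m x)\<^sup>2"
  unfolding eucl_norm_sq by (simp add: power2_eq_square)

lemma eucl_norm_lin_apply_sq:
  "(eucl_norm t (lin_apply t d G x))\<^sup>2 = (\<Sum>i<t. (\<Sum>j<d. G i j * x j)\<^sup>2)"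
  by (simp add: eucl_norm_sq lin_apply_def)

lemma lin_apply_diff:
  "lin_apply t d G (x - y) = lin_apply t d G x - lin_apply t d G y"
  by (auto simp: lin_apply_def fun_eq_iff right_diff_distrib sum_subtractf)

lemma lin_apply_scale_vector:
  "lin_apply t d G (\<lambda>j. c * x j) = (\<lambda>i. c * lin_apply t d G x i)"
  by (auto simp: lin_apply_def fun_eq_iff sum_distrib_left mult_ac)

lemma lin_apply_scale_matrix:
  "lin_apply t d (\<lambda>i j. c * G i j) x = (\<lambda>i. c * lin_apply t d G x i)"
  by (auto simp: lin_apply_def fun_eq_iff sum_distrib_left mult_ac)

subsection \<open>Nets of the unit ball\<close>

text \<open>The weights \<open>(1/2) ^ nat \<bar>z\<bar>\<close> have total below 3 on every
  symmetric interval, whatever its length. This makes the lattice count below exponential in the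
  dimension, with a fixed base.\<close>

lemma sum_half_power_abs: "(\<Sum>z\<in>{- int m..int m}. (1/2::real) ^ nat \<bar>z\<bar>) = 3 - 2 * (1/2) ^ m"
proof (induction m)
  case (Suc m)
  have "{- int (Suc m)..int (Suc m)} = insert (- int (Suc m)) (insert (int (Suc m)) {- int m..int m})"
    by auto
  then show ?case
    using Suc by (simp add: nat_add_distrib)
qed simp

text \<open>The bound on the sum of absolute values drives the count; the box makes the set part of
  a finite product over which sums factor. The radius 2n is what the unit ball needs after scaling
  by 2 sqrt n, since its vectors have absolute sum at most sqrt n.\<close>

definition lattice_ball :: "nat \<Rightarrow> (nat \<Rightarrow> int) set" where
  "lattice_ball n = {z \<in> {..<n} \<rightarrow>\<^sub>E {- int (2*n)..int (2*n)}. (\<Sum>i<n. \<bar>z i\<bar>) \<le> int (2 * n)}"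

lemma finite_lattice_ball: "finite (lattice_ball n)"
  by (rule finite_subset[of _ "{..<n} \<rightarrow>\<^sub>E {- int (2*n)..int (2*n)}"])
     (auto simp: lattice_ball_def intro!: finite_PiE)

text \<open>Weighted counting: the weight of \<open>z\<close> is 4^n divided by 2 to its absolute
  sum, hence at least 1 on \<open>lattice_ball n\<close>. Summed over the whole box the weights
  factor into n one-dimensional sums, each at most 4 * 3.\<close>

lemma card_lattice_ball: "real (card (lattice_ball n)) \<le> 12 ^ n"
proof -
  let ?w = "\<lambda>z. 4 * (1/2::real) ^ nat \<bar>z::int\<bar>"
  have one: "1 \<le> (\<Prod>i<n. ?w (z i))" if "z \<in> lattice_ball n" for z
  proof -
    have "int (\<Sum>i<n. nat \<bar>z i\<bar>) \<le> int (2 * n)"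
      using that by (simp add: lattice_ball_def)
    then have le: "(\<Sum>i<n. nat \<bar>z i\<bar>) \<le> 2 * n"
      by (simp only: of_nat_le_iff)
    have "(\<Prod>i<n. ?w (z i)) = 4 ^ n * (1/2) ^ (\<Sum>i<n. nat \<bar>z i\<bar>)"
      by (simp only: prod.distrib power_sum) simp
    moreover have "(1/2::real) ^ (\<Sum>i<n. nat \<bar>z i\<bar>) \<ge> (1/2) ^ (2 * n)"
      by (rule power_decreasing[OF le]) auto
    moreover have "4 ^ n * (1/2::real) ^ (2 * n) = 1"
      by (simp add: power_mult power2_eq_square flip: power_mult_distrib)
    ultimately show ?thesis
      by (metis mult_left_mono zero_le_numeral zero_le_power)
  qed
  have "real (card (lattice_ball n)) = (\<Sum>z\<in>lattice_ball n. 1)"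
    by simp
  also have "\<dots> \<le> (\<Sum>z\<in>lattice_ball n. \<Prod>i<n. ?w (z i))"
    by (intro sum_mono one)
  also have "\<dots> \<le> (\<Sum>z\<in>{..<n} \<rightarrow>\<^sub>E {- int (2*n)..int (2*n)}. \<Prod>i<n. ?w (z i))"
    by (intro sum_mono2 finite_PiE prod_nonneg) (auto simp: lattice_ball_def)
  also have "\<dots> = (\<Prod>i<n. \<Sum>z\<in>{- int (2*n)..int (2*n)}. ?w z)"
    by (rule prod_sum_PiE[symmetric]) auto
  also have "\<dots> \<le> (\<Prod>i<n. 12)"
  proof (rule prod_mono, intro conjI)
    have "(\<Sum>z\<in>{- int (2*n)..int (2*n)}. ?w z) = 4 * (3 - 2 * (1/2) ^ (2*n))"
      by (subst sum_half_power_abs[symmetric]) (simp only: sum_distrib_left)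
    then show "(\<Sum>z\<in>{- int (2*n)..int (2*n)}. ?w z) \<le> 12"
      by simp
  qed (auto intro: sum_nonneg)
  finally show ?thesis by simp
qed

text \<open>Rounding toward zero rather than to the nearest integer: no coordinate grows, so a
  rounded vector stays in the unit ball.\<close>

lemma trunc_exists:
  fixes a :: real
  obtains z :: int where "\<bar>real_of_int z\<bar> \<le> \<bar>a\<bar>" "\<bar>a - real_of_int z\<bar> \<le> 1"
proof (cases "a \<ge> 0")
  case True
  have "0 \<le> real_of_int \<lfloor>a\<rfloor>" using True by simp
  then show ?thesis
    using that[of "\<lfloor>a\<rfloor>"] True of_int_floor_le[of a] floor_correct[of a] by linarith
next
  case False
  have "real_of_int \<lceil>a\<rceil> \<le> 0" using False by simp
  then show ?thesis
    using that[of "\<lceil>a\<rceil>"] False ceiling_correct[of a] by linarith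
qed

text \<open>The net is a lattice of mesh 1/s with s = 2 sqrt n. Rounding moves each of the n
  coordinates by at most 1/s, so the distance is at most sqrt n / s = 1/2.\<close>

lemma ball_net_exists:
  assumes "n > 0"
  obtains N :: "(nat \<Rightarrow> real) set" where "finite N" "real (card N) \<le> 12 ^ n"
    "\<And>y. y \<in> N \<Longrightarrow> eucl_norm n y \<le> 1"
    "\<And>x. eucl_norm n x \<le> 1 \<Longrightarrow> \<exists>y\<in>N. eucl_norm n (x - y) \<le> 1/2"
proof -
  define s where "s = 2 * sqrt (real n)"
  have s: "s > 0" "s\<^sup>2 = 4 * real n"
    using assms by (auto simp: s_def power_mult_distrib)
  let ?f = "\<lambda>z i. real_of_int (z i) / s"
  \<comment> \<open>The scaled lattice ball can stick out of the Euclidean unit ball. The filter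
    keeps net vectors of norm at most 1, as the tail bound for bilinear forms requires.\<close>
  define N where "N = {y \<in> ?f ` lattice_ball n. eucl_norm n y \<le> 1}"
  have fin: "finite N"
    by (simp add: N_def finite_lattice_ball)
  have "card N \<le> card (?f ` lattice_ball n)"
    by (rule card_mono) (auto simp: N_def finite_lattice_ball)
  also have "\<dots> \<le> card (lattice_ball n)"
    by (rule card_image_le[OF finite_lattice_ball])
  finally have card: "real (card N) \<le> 12 ^ n"
    using card_lattice_ball[of n] by linarith
  have net: "\<exists>y\<in>N. eucl_norm n (x - y) \<le> 1/2" if x: "eucl_norm n x \<le> 1" for x
  proof -
    have "\<exists>z::int. \<bar>real_of_int z\<bar> \<le> \<bar>s * x i\<bar> \<and> \<bar>s * x i - real_of_int z\<bar> \<le> 1" for i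
      using trunc_exists by metis
    then obtain z0 :: "nat \<Rightarrow> int" where z0: "\<And>i. \<bar>real_of_int (z0 i)\<bar> \<le> \<bar>s * x i\<bar>"
      "\<And>i. \<bar>s * x i - real_of_int (z0 i)\<bar> \<le> 1"
      by metis
    define z where "z = restrict z0 {..<n}"
    have "real_of_int (\<Sum>i<n. \<bar>z i\<bar>) = (\<Sum>i<n. \<bar>real_of_int (z0 i)\<bar>)"
      by (simp add: z_def)
    also have "\<dots> \<le> (\<Sum>i<n. \<bar>s * x i\<bar>)"
      by (intro sum_mono z0)
    also have "\<dots> = s * (\<Sum>i<n. \<bar>x i\<bar> * \<bar>1\<bar>)"
      using s by (simp add: abs_mult sum_distrib_left)
    \<comment> \<open>Cauchy-Schwarz against the all-ones vector.\<close>
    also have "\<dots> \<le> s * (L2_set x {..<n} * L2_set (\<lambda>i. 1) {..<n})"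
      using s by (intro mult_left_mono L2_set_mult_ineq) auto
    also have "\<dots> \<le> s * (1 * sqrt (real n))"
      using s x by (simp add: eucl_norm_L2 L2_set_constant mult_left_le_one_le)
    also have "\<dots> = real_of_int (int (2 * n))"
      by (simp add: s_def)
    finally have sum: "(\<Sum>i<n. \<bar>z i\<bar>) \<le> int (2 * n)"
      by (simp only: of_int_le_iff)
    have "\<bar>z i\<bar> \<le> int (2 * n)" if "i < n" for i
      using that sum member_le_sum[of i "{..<n}" "\<lambda>i. \<bar>z i\<bar>"] by simp
    then have zB: "z \<in> lattice_ball n"
      using sum by (force simp: lattice_ball_def z_def PiE_iff abs_le_iff)
    have "\<bar>?f z i\<bar> \<le> \<bar>x i\<bar>" if "i < n" for i
      using z0(1)[of i] s that by (simp add: z_def abs_mult field_simps)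
    then have "(\<Sum>i<n. (?f z i)\<^sup>2) \<le> (\<Sum>i<n. (x i)\<^sup>2)"
      by (intro sum_mono) (simp only: abs_le_square_iff[symmetric] lessThan_iff)
    then have "eucl_norm n (?f z) \<le> 1"
      using x unfolding eucl_norm_def by (meson order_trans real_sqrt_le_mono)
    then have yN: "?f z \<in> N"
      using zB by (auto simp: N_def)
    have "\<bar>x i - ?f z i\<bar> \<le> \<bar>1 / s\<bar>" if "i < n" for i
    proof -
      have "x i - ?f z i = (s * x i - real_of_int (z0 i)) / s"
        using s that by (simp add: z_def field_simps)
      then show ?thesis
        using z0(2)[of i] s by (simp add: divide_right_mono)
    qed
    then have "(\<Sum>i<n. (x i - ?f z i)\<^sup>2) \<le> (\<Sum>i<n. (1/s)\<^sup>2)"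
      by (intro sum_mono) (simp only: abs_le_square_iff[symmetric] lessThan_iff)
    also have "\<dots> = (1/2)\<^sup>2"
      using s assms by (simp add: power_divide)
    finally have "eucl_norm n (x - ?f z) \<le> 1/2"
      unfolding eucl_norm_def by (intro real_le_lsqrt) auto
    then show ?thesis
      using yN by blast
  qed
  show ?thesis
    by (rule that[OF fin card _ net]) (auto simp: N_def)
qed

section \<open>Norms and operator norms controlled on nets\<close>

lemma eucl_norm_le_by_net:
  assumes net: "\<And>x. eucl_norm m x \<le> 1 \<Longrightarrow> \<exists>y\<in>N. eucl_norm m (x - y) \<le> 1/2"
    and b: "\<And>u. u \<in> N \<Longrightarrow> (\<Sum>i<m. u i * w i) \<le> s" and "s \<ge> 0"
  shows "eucl_norm m w \<le> 2 * s"
proof (cases "eucl_norm m w = 0")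
  case False
  define a where "a = eucl_norm m w"
  have a: "a > 0" using False by (simp add: a_def less_le)
  \<comment> \<open>The inner product of \<open>w\<close> with its own direction \<open>x\<close> is
    its norm \<open>a\<close>. Replacing \<open>x\<close> by a net vector loses at most
    \<open>a / 2\<close>, which is then absorbed on the left.\<close>
  define x where "x = (\<lambda>i. (1/a) * w i)"
  have "eucl_norm m x = 1"
    unfolding x_def eucl_norm_scale using a by (simp add: a_def)
  then obtain u where u: "u \<in> N" "eucl_norm m (x - u) \<le> 1/2"
    using net[of x] by auto
  have "a = (\<Sum>i<m. x i * w i)"
  proof -
    have "(\<Sum>i<m. x i * w i) = (1/a) * (\<Sum>i<m. w i * w i)"
      by (simp add: x_def sum_divide_distrib)
    then show ?thesis
      using a by (simp add: inner_self a_def power2_eq_square)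
  qed
  also have "\<dots> = (\<Sum>i<m. u i * w i) + (\<Sum>i<m. (x - u) i * w i)"
    by (simp add: left_diff_distrib sum_subtractf)
  also have "\<dots> \<le> s + eucl_norm m (x - u) * a"
    unfolding a_def by (intro add_mono b u inner_le_eucl_norm)
  also have "\<dots> \<le> s + (1/2) * a"
    using u a by (intro add_left_mono mult_right_mono) auto
  finally show ?thesis by (simp add: a_def)
qed (use assms in simp)

text \<open>Cauchy-Schwarz in each row gives this Frobenius bound. It is crude, but it makes the
  supremum defining the operator norm finite and sends vectors of norm 0 to vectors of norm
  0.\<close>

lemma lin_apply_bounded:
  "eucl_norm t (lin_apply t d G x) \<le> sqrt (\<Sum>i<t. (eucl_norm d (G i))\<^sup>2) * eucl_norm d x"
proof -
  have "(\<Sum>i<t. (\<Sum>j<d. G i j * x j)\<^sup>2) \<le> (\<Sum>i<t. (eucl_norm d (G i))\<^sup>2 * (eucl_norm d x)\<^sup>2)"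
  proof (rule sum_mono)
    fix i
    have "(\<Sum>j<d. G i j * x j) \<le> eucl_norm d (G i) * eucl_norm d x"
      by (rule inner_le_eucl_norm)
    moreover have "- (\<Sum>j<d. G i j * x j) \<le> eucl_norm d (G i) * eucl_norm d x"
      using inner_le_eucl_norm[of "G i" "\<lambda>j. - x j" d]
      by (simp add: sum_negf) (simp add: eucl_norm_def)
    ultimately have "\<bar>\<Sum>j<d. G i j * x j\<bar> \<le> \<bar>eucl_norm d (G i) * eucl_norm d x\<bar>"
      by linarith
    then show "(\<Sum>j<d. G i j * x j)\<^sup>2 \<le> (eucl_norm d (G i))\<^sup>2 * (eucl_norm d x)\<^sup>2"
      by (simp only: abs_le_square_iff power_mult_distrib)
  qed
  then have "(eucl_norm t (lin_apply t d G x))\<^sup>2 \<le> (sqrt (\<Sum>i<t. (eucl_norm d (G i))\<^sup>2) * eucl_norm d x)\<^sup>2"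
    by (simp add: eucl_norm_lin_apply_sq sum_distrib_right power_mult_distrib sum_nonneg)
  then show ?thesis
    by (rule power2_le_imp_le) (simp add: sum_nonneg)
qed

text \<open>With \<sigma> the supremum over the unit ball, approximating x by a net vector costs at
  most \<sigma>/2, and the second net bounds the image of a net vector by 2s. As \<sigma> is finite,
  \<sigma> \<le> 2s + \<sigma>/2 gives \<sigma> \<le> 4s.\<close>

lemma operator_norm_by_nets:
  assumes netd: "\<And>x. eucl_norm d x \<le> 1 \<Longrightarrow> \<exists>y\<in>N. eucl_norm d (x - y) \<le> 1/2"
    and nett: "\<And>x. eucl_norm t x \<le> 1 \<Longrightarrow> \<exists>y\<in>N'. eucl_norm t (x - y) \<le> 1/2"
    and b: "\<And>u y. u \<in> N' \<Longrightarrow> y \<in> N \<Longrightarrow> (\<Sum>i<t. u i * lin_apply t d G y i) \<le> s"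
    and s: "s \<ge> 0"
  shows "eucl_norm t (lin_apply t d G x) \<le> 4 * s * eucl_norm d x"
proof -
  let ?g = "\<lambda>x. eucl_norm t (lin_apply t d G x)"
  define B where "B = {x. eucl_norm d x \<le> 1}"
  have B0: "(\<lambda>_. 0) \<in> B" by (simp add: B_def eucl_norm_def)
  have bdd: "bdd_above (?g ` B)"
  proof (rule bdd_aboveI2)
    fix x assume "x \<in> B"
    then show "?g x \<le> sqrt (\<Sum>i<t. (eucl_norm d (G i))\<^sup>2) * 1"
      by (intro order_trans[OF lin_apply_bounded] mult_left_mono) (auto simp: B_def sum_nonneg)
  qed
  define \<sigma> where "\<sigma> = (SUP x\<in>B. ?g x)"
  have up: "?g x \<le> \<sigma>" if "x \<in> B" for x
    unfolding \<sigma>_def using bdd that by (rule cSUP_upper2) auto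
  have hom: "?g x \<le> \<sigma> * eucl_norm d x" for x
  proof (cases "eucl_norm d x = 0")
    \<comment> \<open>Norm 0 constrains only the coordinates below \<open>d\<close>, and such a
      vector cannot be normalised; the Frobenius bound takes over.\<close>
    case True
    then show ?thesis
      using lin_apply_bounded[of t d G x] by simp
  next
    case False
    define a where "a = eucl_norm d x"
    have a: "a > 0" using False by (simp add: a_def less_le)
    have "(\<lambda>j. (1/a) * x j) \<in> B"
      unfolding B_def mem_Collect_eq eucl_norm_scale using a by (simp add: a_def)
    then have "(1/a) * ?g x \<le> \<sigma>"
      using up[of "\<lambda>j. (1/a) * x j"] a
      unfolding lin_apply_scale_vector eucl_norm_scale by simp
    then show ?thesis using a by (simp add: a_def field_simps)
  qed
  have "?g x \<le> 2 * s + \<sigma> / 2" if x: "x \<in> B" for x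
  proof -
    obtain y where y: "y \<in> N" "eucl_norm d (x - y) \<le> 1/2"
      using x netd by (auto simp: B_def)
    have \<sigma>0: "\<sigma> \<ge> 0" using up[OF B0] eucl_norm_nonneg order_trans by blast
    have "?g x = eucl_norm t (\<lambda>i. lin_apply t d G y i + lin_apply t d G (x - y) i)"
      by (simp add: lin_apply_diff)
    also have "\<dots> \<le> ?g y + ?g (x - y)"
      by (rule eucl_norm_triangle)
    also have "\<dots> \<le> 2 * s + \<sigma> * (1/2)"
      using y \<sigma>0
      by (intro add_mono eucl_norm_le_by_net[of t N'] nett b s order_trans[OF hom] mult_left_mono) auto
    finally show ?thesis by simp
  qed
  then have "\<sigma> \<le> 2 * s + \<sigma> / 2"
    unfolding \<sigma>_def using B0 by (intro cSUP_least) auto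
  then have "\<sigma> \<le> 4 * s" by simp
  then show ?thesis
    using hom[of x] by (meson eucl_norm_nonneg mult_right_mono order_trans)
qed


subsection \<open>Random sign matrices\<close>

lemma fact_double_ge: "2 ^ n * fact n \<le> (fact (2 * n) :: real)"
proof (induction n)
  case (Suc n)
  have "2 ^ Suc n * fact (Suc n) = (2 * (real n + 1)) * (2 ^ n * fact n :: real)"
    by (simp add: algebra_simps)
  also have "\<dots> \<le> (2 * (real n + 1)) * fact (2 * n)"
    using Suc by (intro mult_left_mono) auto
  also have "\<dots> \<le> (2 * (real n + 1)) * ((2 * real n + 1) * fact (2 * n))"
    by (intro mult_left_mono) (auto simp: mult_le_cancel_right1)
  also have "\<dots> = fact (2 * Suc n)"
    by (simp add: algebra_simps)
  finally show ?case .
qed simp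

text \<open>Termwise comparison of power series: the coefficients of x^(2n) are 1/(2n)! and 1/(2^n
  n!).\<close>

lemma cosh_le_exp_half_square: "cosh (x::real) \<le> exp (x\<^sup>2 / 2)"
proof (rule sums_le)
  let ?c = "\<lambda>n. if even n then x ^ n /\<^sub>R fact n else 0"
  \<comment> \<open>The library series for \<open>cosh\<close> carries zeros at odd indices;
    reindexing along the even ones drops them.\<close>
  have "(\<lambda>n. ?c (2 * n)) sums cosh x \<longleftrightarrow> ?c sums cosh x"
    by (rule sums_mono_reindex) (auto simp: strict_mono_def elim!: evenE)
  then show "(\<lambda>n. x ^ (2 * n) / fact (2 * n)) sums cosh x"
    using cosh_converges[of x] by (simp add: field_simps)
  show "(\<lambda>n. (x\<^sup>2 / 2) ^ n /\<^sub>R fact n) sums exp (x\<^sup>2 / 2)"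
    by (rule exp_converges)
  fix n
  have "x ^ (2 * n) / fact (2 * n) \<le> x ^ (2 * n) / (2 ^ n * fact n)"
    using fact_double_ge[of n] by (intro divide_left_mono) (auto simp: power_mult)
  also have "\<dots> = (x\<^sup>2 / 2) ^ n /\<^sub>R fact n"
    unfolding power_divide power_mult[symmetric] by (simp add: field_simps)
  finally show "x ^ (2 * n) / fact (2 * n) \<le> (x\<^sup>2 / 2) ^ n /\<^sub>R fact n" .
qed

definition sign_vectors :: "nat \<Rightarrow> (nat \<Rightarrow> real) set" where
  "sign_vectors d = {..<d} \<rightarrow>\<^sub>E {-1, 1}"

text \<open>Probability is done by counting: sums over this finite set are unnormalised
  expectations. Indexing by rows first expresses the independence of rows as a product of
  sums.\<close>

definition sign_matrices :: "nat \<Rightarrow> nat \<Rightarrow> (nat \<Rightarrow> nat \<Rightarrow> real) set" where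
  "sign_matrices t d = {..<t} \<rightarrow>\<^sub>E sign_vectors d"

lemma finite_sign_vectors [simp]: "finite (sign_vectors d)"
  by (simp add: sign_vectors_def finite_PiE)

lemma card_sign_vectors: "card (sign_vectors d) = 2 ^ d"
  by (simp add: sign_vectors_def card_PiE numeral_2_eq_2)

lemma finite_sign_matrices [simp]: "finite (sign_matrices t d)"
  by (simp add: sign_matrices_def finite_PiE)

lemma card_sign_matrices: "card (sign_matrices t d) = (2 ^ d) ^ t"
  by (simp add: sign_matrices_def card_PiE card_sign_vectors)

lemma sum_sign_matrices_prod:
  fixes F :: "nat \<Rightarrow> (nat \<Rightarrow> real) \<Rightarrow> real"
  shows "(\<Sum>\<epsilon>\<in>sign_matrices t d. \<Prod>i<t. F i (\<epsilon> i)) = (\<Prod>i<t. \<Sum>r\<in>sign_vectors d. F i r)"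
  unfolding sign_matrices_def by (rule prod_sum_PiE[symmetric]) auto

text \<open>Random signs are sub-Gaussian: the moment generating function factors over the
  coordinates into values of \<open>cosh\<close>.\<close>

lemma sum_sign_vectors_exp:
  "(\<Sum>r\<in>sign_vectors d. exp (\<Sum>j<d. a j * r j)) \<le> 2 ^ d * exp ((\<Sum>j<d. (a j)\<^sup>2) / 2)"
proof -
  have "(\<Sum>r\<in>sign_vectors d. exp (\<Sum>j<d. a j * r j)) = (\<Prod>j<d. \<Sum>z\<in>{-1, 1}. exp (a j * z))"
    unfolding sign_vectors_def by (subst prod_sum_PiE) (auto simp: exp_sum)
  also have "\<dots> = (\<Prod>j<d. 2 * cosh (a j))"
    by (intro prod.cong) (auto simp: cosh_def)
  also have "\<dots> \<le> (\<Prod>j<d. 2 * exp ((a j)\<^sup>2 / 2))"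
    by (intro prod_mono) (auto simp: cosh_le_exp_half_square)
  also have "\<dots> = 2 ^ d * exp ((\<Sum>j<d. (a j)\<^sup>2) / 2)"
    by (simp add: prod.distrib exp_sum sum_divide_distrib)
  finally show ?thesis .
qed

text \<open>Splitting off the last sign is the induction step for the moments; on adding both cases
  the odd powers cancel.\<close>

lemma sum_sign_vectors_Suc:
  fixes F :: "(nat \<Rightarrow> real) \<Rightarrow> real"
  shows "(\<Sum>r\<in>sign_vectors (Suc d). F r) = (\<Sum>r\<in>sign_vectors d. F (r(d := -1)) + F (r(d := 1)))"
proof -
  have "(\<Sum>r\<in>sign_vectors (Suc d). F r) =
      (\<Sum>(z, r)\<in>{-1, 1} \<times> sign_vectors d. F (r(d := z)))"
    unfolding sign_vectors_def lessThan_Suc PiE_insert_eq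
    by (subst sum.reindex[OF inj_combinator]) (auto simp: case_prod_unfold)
  also have "\<dots> = (\<Sum>z\<in>{-1, 1}. \<Sum>r\<in>sign_vectors d. F (r(d := z)))"
    by (simp only: sum.cartesian_product)
  finally show ?thesis by (simp add: sum.distrib)
qed

lemma sum_sign_vectors_moment2:
  "(\<Sum>r\<in>sign_vectors d. (\<Sum>j<d. r j * v j)\<^sup>2) = 2 ^ d * (\<Sum>j<d. (v j)\<^sup>2)"
proof (induction d)
  case (Suc d)
  let ?Y = "\<lambda>r. \<Sum>j<d. r j * v j"
  have "(\<Sum>r\<in>sign_vectors (Suc d). (\<Sum>j<Suc d. r j * v j)\<^sup>2)
      = (\<Sum>r\<in>sign_vectors d. (?Y r - v d)\<^sup>2 + (?Y r + v d)\<^sup>2)"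
    by (simp add: sum_sign_vectors_Suc)
  also have "\<dots> = (\<Sum>r\<in>sign_vectors d. 2 * (?Y r)\<^sup>2 + 2 * (v d)\<^sup>2)"
    by (intro sum.cong) (auto simp: power2_eq_square algebra_simps)
  also have "\<dots> = 2 ^ Suc d * (\<Sum>j<Suc d. (v j)\<^sup>2)"
    by (simp only: sum.distrib sum_distrib_left[symmetric] Suc)
       (simp add: card_sign_vectors algebra_simps)
  finally show ?case .
qed (simp add: sign_vectors_def)

lemma sum_sign_vectors_moment4:
  "(\<Sum>r\<in>sign_vectors d. (\<Sum>j<d. r j * v j) ^ 4) \<le> 3 * 2 ^ d * (\<Sum>j<d. (v j)\<^sup>2)\<^sup>2"
proof (induction d)
  case (Suc d)
  let ?Y = "\<lambda>r. \<Sum>j<d. r j * v j"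
  let ?a = "\<Sum>j<d. (v j)\<^sup>2"
  have "(\<Sum>r\<in>sign_vectors (Suc d). (\<Sum>j<Suc d. r j * v j) ^ 4)
      = (\<Sum>r\<in>sign_vectors d. (?Y r - v d) ^ 4 + (?Y r + v d) ^ 4)"
    by (simp add: sum_sign_vectors_Suc)
  also have "\<dots> = (\<Sum>r\<in>sign_vectors d. 2 * (?Y r) ^ 4 + 12 * (v d)\<^sup>2 * (?Y r)\<^sup>2 + 2 * (v d) ^ 4)"
    by (intro sum.cong) (auto simp: eval_nat_numeral algebra_simps)
  also have "\<dots> = 2 * (\<Sum>r\<in>sign_vectors d. (?Y r) ^ 4)
      + 12 * (v d)\<^sup>2 * (2 ^ d * ?a) + 2 ^ d * (2 * (v d) ^ 4)"
    by (simp only: sum.distrib sum_distrib_left[symmetric] sum_sign_vectors_moment2)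
       (simp add: card_sign_vectors)
  \<comment> \<open>Besides the induction hypothesis, 2 v^4 is relaxed to 6 v^4, exactly what
    completes the square of \<open>?a + (v d)\<^sup>2\<close>.\<close>
  also have "\<dots> \<le> 2 * (3 * 2 ^ d * ?a\<^sup>2) + 12 * (v d)\<^sup>2 * (2 ^ d * ?a) + 2 ^ d * (6 * (v d) ^ 4)"
    using Suc by (intro add_mono mult_left_mono) auto
  also have "\<dots> = 3 * 2 ^ Suc d * (?a + (v d)\<^sup>2)\<^sup>2"
    by (simp add: power2_eq_square power4_eq_xxxx algebra_simps)
  finally show ?case by simp
qed (simp add: sign_vectors_def)

text \<open>The Taylor bound 1 + s + s^2/2 \<le> exp s is inverted through (1 - s + s^2/2)(1 + s +
  s^2/2) = 1 + s^4/4. With s a multiple of a squared sign sum, second and fourth moments then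
  suffice to bound a Laplace transform.\<close>

lemma exp_minus_le_quadratic:
  assumes "0 \<le> (s::real)"
  shows "exp (- s) \<le> 1 - s + s\<^sup>2 / 2"
proof -
  have pos: "0 < 1 + s + s\<^sup>2 / 2"
    using assms by (simp add: add_pos_nonneg)
  have "exp (- s) = 1 / exp s"
    by (simp add: exp_minus inverse_eq_divide)
  also have "\<dots> \<le> 1 / (1 + s + s\<^sup>2 / 2)"
    using exp_lower_Taylor_quadratic[OF assms] pos by (intro divide_left_mono) auto
  also have "\<dots> \<le> 1 - s + s\<^sup>2 / 2"
  proof -
    have "(1 - s + s\<^sup>2 / 2) * (1 + s + s\<^sup>2 / 2) = 1 + s ^ 4 / 4"
      by (simp add: power2_eq_square power4_eq_xxxx field_simps)
    then have "1 \<le> (1 - s + s\<^sup>2 / 2) * (1 + s + s\<^sup>2 / 2)"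
      by simp
    then show ?thesis using pos by (simp add: divide_le_eq)
  qed
  finally show ?thesis .
qed

section \<open>Tail bounds for sign matrices and the union bound\<close>

lemma card_large_bilinear:
  assumes u: "eucl_norm t u \<le> 1" and y: "eucl_norm d y \<le> 1" and s: "s \<ge> 0"
  shows "real (card {\<epsilon> \<in> sign_matrices t d. s < (\<Sum>i<t. u i * lin_apply t d \<epsilon> y i)})
      \<le> exp (- (s\<^sup>2 / 2)) * real (card (sign_matrices t d))" (is "real (card ?E) \<le> _")
proof -
  let ?B = "\<lambda>\<epsilon>. \<Sum>i<t. u i * lin_apply t d \<epsilon> y i"
  have eq: "exp (s * ?B \<epsilon>) = (\<Prod>i<t. exp (\<Sum>j<d. (s * u i * y j) * \<epsilon> i j))" for \<epsilon>
    by (simp add: lin_apply_def sum_distrib_left mult_ac flip: exp_sum)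
  \<comment> \<open>Chernoff's method with exponent parameter equal to the threshold
    \<open>s\<close>: the moment generating function is at most exp(s^2/2), and dividing by exp(s^2)
    leaves exp(-s^2/2).\<close>
  have "real (card ?E) * exp (s * s) = (\<Sum>\<epsilon>\<in>?E. exp (s * s))"
    by simp
  also have "\<dots> \<le> (\<Sum>\<epsilon>\<in>?E. exp (s * ?B \<epsilon>))"
    using s by (intro sum_mono) (auto intro: mult_left_mono)
  also have "\<dots> \<le> (\<Sum>\<epsilon>\<in>sign_matrices t d. exp (s * ?B \<epsilon>))"
    by (intro sum_mono2) auto
  also have "\<dots> = (\<Prod>i<t. \<Sum>r\<in>sign_vectors d. exp (\<Sum>j<d. (s * u i * y j) * r j))"
    unfolding eq by (rule sum_sign_matrices_prod)
  also have "\<dots> \<le> (\<Prod>i<t. 2 ^ d * exp ((\<Sum>j<d. (s * u i * y j)\<^sup>2) / 2))"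
    by (intro prod_mono conjI sum_sign_vectors_exp sum_nonneg) auto
  also have "\<dots> = (2 ^ d) ^ t * exp (\<Sum>i<t. (\<Sum>j<d. (s * u i * y j)\<^sup>2) / 2)"
    by (simp add: prod.distrib exp_sum)
  also have "(\<Sum>i<t. (\<Sum>j<d. (s * u i * y j)\<^sup>2) / 2) = (eucl_norm t u)\<^sup>2 * (eucl_norm d y)\<^sup>2 * (s\<^sup>2 / 2)"
    unfolding eucl_norm_sq sum_product
    by (simp add: sum_distrib_right sum_distrib_left sum_divide_distrib power_mult_distrib mult_ac)
  also have "(2 ^ d) ^ t * exp \<dots> \<le> (2 ^ d) ^ t * exp (1 * 1 * (s\<^sup>2 / 2))"
    using u y by (simp add: mult_left_le_one_le mult_le_one abs_square_le_1)
  finally have "real (card ?E) * exp (s * s) \<le> exp (s\<^sup>2 / 2) * real (card (sign_matrices t d))"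
    by (simp add: card_sign_matrices mult.commute)
  moreover have "exp (s\<^sup>2 / 2) = exp (- (s\<^sup>2 / 2)) * exp (s * s)"
    by (simp add: power2_eq_square flip: exp_add)
  ultimately have "real (card ?E) * exp (s * s)
      \<le> (exp (- (s\<^sup>2 / 2)) * real (card (sign_matrices t d))) * exp (s * s)"
    by (simp add: mult_ac)
  then show ?thesis
    by (rule mult_right_le_imp_le) simp
qed

text \<open>Markov's inequality for the exponential of minus the sum of the squared row products
  over 3a, where a is the squared norm of \<open>v\<close>. One row contributes a mean of at most 1
  - 1/3 + 1/6 = 5/6 \<le> exp(-3/20). On the bad event the sum is at most t/10, so exp(-3t/20 +
  t/10) = exp(-t/20) remains.\<close>

lemma card_small_image:
  "real (card {\<epsilon> \<in> sign_matrices t d. eucl_norm t (lin_apply t d \<epsilon> v) < sqrt (3/10 * real t) * eucl_norm d v})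
      \<le> exp (- real t / 20) * real (card (sign_matrices t d))" (is "real (card ?E) \<le> _")
proof (cases "eucl_norm d v = 0")
  case True
  then have "?E = {}" by (simp add: not_less)
  then show ?thesis by (simp only:) simp
next
  case False
  define a where "a = (\<Sum>j<d. (v j)\<^sup>2)"
  have a: "a > 0"
    using False eucl_norm_sq[of d v] by (metis a_def zero_less_power2)
  let ?Y = "\<lambda>r. \<Sum>j<d. r j * v j"
  let ?f = "\<lambda>r. exp (- ((?Y r)\<^sup>2 / (3 * a)))"
  have row: "(\<Sum>r\<in>sign_vectors d. ?f r) \<le> 2 ^ d * exp (- 3/20)"
  proof -
    have "(\<Sum>r\<in>sign_vectors d. ?f r) \<le>
        (\<Sum>r\<in>sign_vectors d. 1 - (?Y r)\<^sup>2 / (3 * a) + ((?Y r)\<^sup>2 / (3 * a))\<^sup>2 / 2)"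
      using a by (intro sum_mono exp_minus_le_quadratic) auto
    also have "\<dots> = (\<Sum>r\<in>sign_vectors d. 1 - 1 / (3 * a) * (?Y r)\<^sup>2 + 1 / (18 * a\<^sup>2) * (?Y r) ^ 4)"
      by (intro sum.cong) (auto simp: power_divide power_mult_distrib simp flip: power_mult)
    also have "\<dots> = 2 ^ d - 1 / (3 * a) * (2 ^ d * a) + 1 / (18 * a\<^sup>2) * (\<Sum>r\<in>sign_vectors d. (?Y r) ^ 4)"
      by (simp only: sum.distrib sum_subtractf sum_distrib_left[symmetric] sum_sign_vectors_moment2 a_def)
         (simp add: card_sign_vectors)
    also have "\<dots> \<le> 2 ^ d - 1 / (3 * a) * (2 ^ d * a) + 1 / (18 * a\<^sup>2) * (3 * 2 ^ d * a\<^sup>2)"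
      unfolding a_def by (intro add_left_mono mult_left_mono sum_sign_vectors_moment4) simp
    also have "\<dots> = 2 ^ d * (5/6)"
      using a by (simp add: field_simps)
    also have "\<dots> \<le> 2 ^ d * exp (- 3/20)"
    proof -
      have "exp (3/20::real) \<le> 6/5"
        using exp_bound[of "3/20"] by (simp add: power2_eq_square)
      then have "5/6 \<le> exp (- (3/20::real))"
        by (simp add: exp_minus field_simps)
      then show ?thesis by simp
    qed
    finally show ?thesis .
  qed
  have small: "exp (- real t / 10) \<le> (\<Prod>i<t. ?f (\<epsilon> i))" if "\<epsilon> \<in> ?E" for \<epsilon>
  proof -
    have "(eucl_norm t (lin_apply t d \<epsilon> v))\<^sup>2 \<le> (sqrt (3/10 * real t) * eucl_norm d v)\<^sup>2"
      using that by (intro power_mono) auto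
    then have "(\<Sum>i<t. (?Y (\<epsilon> i))\<^sup>2) \<le> 3/10 * real t * a"
      unfolding eucl_norm_lin_apply_sq power_mult_distrib eucl_norm_sq[of d v] a_def by simp
    then have "(\<Sum>i<t. (?Y (\<epsilon> i))\<^sup>2 / (3 * a)) \<le> real t / 10"
      using a by (simp add: field_simps flip: sum_divide_distrib)
    then have "- real t / 10 \<le> (\<Sum>i<t. - ((?Y (\<epsilon> i))\<^sup>2 / (3 * a)))"
      by (simp add: sum_negf)
    then show ?thesis
      by (simp flip: exp_sum)
  qed
  have "real (card ?E) * exp (- real t / 10) = (\<Sum>\<epsilon>\<in>?E. exp (- real t / 10))"
    by simp
  also have "\<dots> \<le> (\<Sum>\<epsilon>\<in>?E. \<Prod>i<t. ?f (\<epsilon> i))"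
    by (intro sum_mono small)
  also have "\<dots> \<le> (\<Sum>\<epsilon>\<in>sign_matrices t d. \<Prod>i<t. ?f (\<epsilon> i))"
    by (intro sum_mono2 prod_nonneg) auto
  also have "\<dots> = (\<Prod>i<t. \<Sum>r\<in>sign_vectors d. ?f r)"
    by (rule sum_sign_matrices_prod)
  also have "\<dots> \<le> (\<Prod>i<t. 2 ^ d * exp (- 3/20))"
    by (intro prod_mono conjI row sum_nonneg) auto
  also have "\<dots> = (2 ^ d) ^ t * (exp (- real t / 20) * exp (- real t / 10))"
  proof -
    have "real t * (- 3/20) = - real t / 20 + - real t / 10"
      by simp
    then have "exp (- 3/20 :: real) ^ t = exp (- real t / 20) * exp (- real t / 10)"
      by (metis exp_add exp_of_nat_mult)
    then show ?thesis
      by (simp only: prod_constant card_lessThan power_mult_distrib)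
  qed
  finally have "real (card ?E) * exp (- real t / 10)
      \<le> (exp (- real t / 20) * real (card (sign_matrices t d))) * exp (- real t / 10)"
    by (simp add: card_sign_matrices mult_ac)
  then show ?thesis
    by (rule mult_right_le_imp_le) simp
qed


text \<open>Union bound: at most 12^(d+t) net pairs fail with probability at most exp(-3(d+t+1))
  \<le> 12^-(d+t+1) each, in total 1/12. The vectors of \<open>V\<close> add at most 1/4, and 1/12 +
  1/4 = 1/3.\<close>

lemma card_good_sign_matrices:
  assumes "d > 0" "t > 0" and V: "finite V" "real (card V) * exp (- real t / 20) \<le> 1/4"
  defines "L \<equiv> 4 * sqrt (6 * (real d + real t + 1))"
  shows "2/3 * real (card (sign_matrices t d)) \<le> real (card {\<epsilon> \<in> sign_matrices t d.
      (\<forall>x. eucl_norm t (lin_apply t d \<epsilon> x) \<le> L * eucl_norm d x) \<and>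
      (\<forall>v\<in>V. sqrt (3/10 * real t) * eucl_norm d v \<le> eucl_norm t (lin_apply t d \<epsilon> v))})"
    (is "_ \<le> real (card ?Good)")
proof -
  let ?\<Omega> = "sign_matrices t d"
  let ?n = "real (card ?\<Omega>)"
  obtain N where N: "finite N" "real (card N) \<le> 12 ^ d" "\<And>y. y \<in> N \<Longrightarrow> eucl_norm d y \<le> 1"
    "\<And>x. eucl_norm d x \<le> 1 \<Longrightarrow> \<exists>y\<in>N. eucl_norm d (x - y) \<le> 1/2"
    using ball_net_exists[OF \<open>d > 0\<close>] by blast
  obtain N' where N': "finite N'" "real (card N') \<le> 12 ^ t" "\<And>y. y \<in> N' \<Longrightarrow> eucl_norm t y \<le> 1"
    "\<And>x. eucl_norm t x \<le> 1 \<Longrightarrow> \<exists>y\<in>N'. eucl_norm t (x - y) \<le> 1/2"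
    using ball_net_exists[OF \<open>t > 0\<close>] by blast
  define s where "s = sqrt (6 * (real d + real t + 1))"
  have s: "s \<ge> 0" "s\<^sup>2 / 2 = 3 * (real d + real t + 1)"
    by (auto simp: s_def)
  define E where "E = (\<lambda>(u, y). {\<epsilon> \<in> ?\<Omega>. s < (\<Sum>i<t. u i * lin_apply t d \<epsilon> y i)})"
  define F where "F = (\<lambda>v. {\<epsilon> \<in> ?\<Omega>. eucl_norm t (lin_apply t d \<epsilon> v) < sqrt (3/10 * real t) * eucl_norm d v})"
  have fin: "finite (E p)" "finite (F v)" for p v
    by (auto simp: E_def F_def case_prod_unfold)
  have cover: "?\<Omega> - ?Good \<subseteq> (\<Union>p\<in>N' \<times> N. E p) \<union> (\<Union>v\<in>V. F v)"
  proof
    fix \<epsilon> assume \<epsilon>: "\<epsilon> \<in> ?\<Omega> - ?Good"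
    show "\<epsilon> \<in> (\<Union>p\<in>N' \<times> N. E p) \<union> (\<Union>v\<in>V. F v)"
    proof (rule ccontr)
      assume no: "\<epsilon> \<notin> (\<Union>p\<in>N' \<times> N. E p) \<union> (\<Union>v\<in>V. F v)"
      have "(\<Sum>i<t. u i * lin_apply t d \<epsilon> y i) \<le> s" if "u \<in> N'" "y \<in> N" for u y
        using no \<epsilon> that by (force simp: E_def not_less)
      then have "eucl_norm t (lin_apply t d \<epsilon> x) \<le> 4 * s * eucl_norm d x" for x
        by (intro operator_norm_by_nets[OF N(4) N'(4) _ s(1)])
      moreover have "sqrt (3/10 * real t) * eucl_norm d v \<le> eucl_norm t (lin_apply t d \<epsilon> v)" if "v \<in> V" for v
        using no \<epsilon> that by (force simp: F_def not_less)
      ultimately show False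
        using \<epsilon> by (auto simp: L_def s_def)
    qed
  qed
  have "card (?\<Omega> - ?Good) \<le> card ((\<Union>p\<in>N' \<times> N. E p) \<union> (\<Union>v\<in>V. F v))"
    by (rule card_mono[OF _ cover]) (auto simp: N N' V fin)
  also have "\<dots> \<le> (\<Sum>p\<in>N' \<times> N. card (E p)) + (\<Sum>v\<in>V. card (F v))"
    by (intro order_trans[OF card_Un_le] add_mono card_UN_le) (auto simp: N N' V)
  finally have "real (card (?\<Omega> - ?Good)) \<le> (\<Sum>p\<in>N' \<times> N. real (card (E p))) + (\<Sum>v\<in>V. real (card (F v)))"
    by (simp only: of_nat_sum[symmetric] of_nat_add[symmetric] of_nat_le_iff)
  also have "\<dots> \<le> (\<Sum>p\<in>N' \<times> N. exp (- (s\<^sup>2 / 2)) * ?n) + (\<Sum>v\<in>V. exp (- real t / 20) * ?n)"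
  proof (intro add_mono sum_mono)
    fix p assume "p \<in> N' \<times> N"
    then show "real (card (E p)) \<le> exp (- (s\<^sup>2 / 2)) * ?n"
      unfolding E_def case_prod_unfold
      by (intro card_large_bilinear) (use N(3) N'(3) s(1) in auto)
  qed (unfold F_def, rule card_small_image)
  also have "\<dots> = (real (card N') * real (card N) * exp (- (s\<^sup>2 / 2))) * ?n
      + (real (card V) * exp (- real t / 20)) * ?n"
    by (simp add: card_cartesian_product)
  also have "\<dots> \<le> (1/12) * ?n + (1/4) * ?n"
  proof (intro add_mono mult_right_mono V)
    have e3: "12 \<le> exp (3::real)"
    proof -
      have "(5/2) ^ 3 \<le> exp (1::real) ^ 3"
        using exp_lower_Taylor_quadratic[of 1] by (intro power_mono) auto
      also have "\<dots> = exp 3"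
        by (simp flip: exp_of_nat_mult)
      finally show ?thesis by (simp add: power3_eq_cube)
    qed
    have "real (card N') * real (card N) \<le> 12 ^ t * 12 ^ d"
      by (intro mult_mono N N') auto
    then have "12 * (real (card N') * real (card N)) \<le> 12 ^ (d + t + 1)"
      by (simp add: power_add mult_ac)
    also have "\<dots> \<le> exp 3 ^ (d + t + 1)"
      by (intro power_mono e3) auto
    also have "\<dots> = exp (s\<^sup>2 / 2)"
      unfolding s exp_of_nat_mult[symmetric] by (simp add: mult_ac)
    finally show "real (card N') * real (card N) * exp (- (s\<^sup>2 / 2)) \<le> 1/12"
      by (simp add: exp_minus field_simps)
  qed auto
  also have "\<dots> = ?n / 3"
    by simp
  finally have "real (card (?\<Omega> - ?Good)) \<le> ?n / 3" .
  moreover have "real (card (?\<Omega> - ?Good)) = ?n - real (card ?Good)"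
    by (subst card_Diff_subset) (auto intro!: of_nat_diff card_mono)
  ultimately show ?thesis by simp
qed

subsection \<open>Cluster radii and diameters\<close>

text \<open>Any point of the cluster serves as a centre. With the converse below, radius and
  diameter agree up to a factor 2, so pairwise distances control radii. The bound
  \<open>D \<ge> 0\<close> covers the empty cluster, whose radius is 0 by convention.\<close>

lemma cluster_radius_le_diameter:
  assumes "finite S" "D \<ge> 0" and D: "\<And>i j. i \<in> S \<Longrightarrow> j \<in> S \<Longrightarrow> eucl_norm m (X i - X j) \<le> D"
  shows "cluster_radius m X S \<le> D"
proof (cases "S = {}")
  case False
  then obtain j where j: "j \<in> S" by blast
  have "bdd_below (range (\<lambda>c. Max ((\<lambda>i. eucl_norm m (X i - c)) ` S)))"
    using False \<open>finite S\<close> j by (intro bdd_belowI2[of _ 0]) (auto simp: Max_ge_iff intro!: bexI[of _ j])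
  moreover have "Max ((\<lambda>i. eucl_norm m (X i - X j)) ` S) \<le> D"
    using \<open>finite S\<close> False by (intro Max.boundedI) (auto intro: D[OF _ j])
  ultimately have "(INF c. Max ((\<lambda>i. eucl_norm m (X i - c)) ` S)) \<le> D"
    by (intro cINF_lower2[where x = "X j"]) auto
  then show ?thesis
    using False by (simp add: cluster_radius_def)
qed (use assms in \<open>simp add: cluster_radius_def\<close>)

text \<open>The triangle inequality through an arbitrary centre gives the bound for each centre,
  hence for the infimum.\<close>

lemma diameter_le_cluster_radius:
  assumes "finite S" "i \<in> S" "j \<in> S"
  shows "eucl_norm m (X i - X j) \<le> 2 * cluster_radius m X S"
proof -
  have "eucl_norm m (X i - X j) / 2 \<le> (INF c. Max ((\<lambda>i. eucl_norm m (X i - c)) ` S))"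
  proof (rule cINF_greatest)
    fix c
    have "eucl_norm m (X l - c) \<le> Max ((\<lambda>i. eucl_norm m (X i - c)) ` S)" if "l \<in> S" for l
      using that assms by auto
    then show "eucl_norm m (X i - X j) / 2 \<le> Max ((\<lambda>i. eucl_norm m (X i - c)) ` S)"
      using eucl_norm_diff_triangle[of m "X i" "X j" c] eucl_norm_diff_commute[of m c "X j"] assms
      by (smt (verit) field_sum_of_halves)
  qed simp
  then show ?thesis
    using assms by (auto simp: cluster_radius_def)
qed

lemma max_radius_le:
  assumes "k \<ge> 1" "D \<ge> 0"
    and "\<And>i j. i < n \<Longrightarrow> j < n \<Longrightarrow> \<pi> i = \<pi> j \<Longrightarrow> eucl_norm m (X i - X j) \<le> D"
  shows "max_radius m n k X \<pi> \<le> D"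
  unfolding max_radius_def
  using assms by (intro Max.boundedI) (auto intro!: cluster_radius_le_diameter simp: lessThan_empty_iff)

lemma le_max_radius:
  assumes \<pi>: "\<pi> \<in> assignments n k" and ij: "i < n" "j < n" "\<pi> i = \<pi> j"
  shows "eucl_norm m (X i - X j) \<le> 2 * max_radius m n k X \<pi>"
proof -
  let ?S = "{l. l < n \<and> \<pi> l = \<pi> j}"
  have "\<pi> j < k" using \<pi> ij by (auto simp: assignments_def)
  then have "cluster_radius m X ?S \<le> max_radius m n k X \<pi>"
    unfolding max_radius_def by (intro Max_ge) auto
  moreover have "eucl_norm m (X i - X j) \<le> 2 * cluster_radius m X ?S"
    using ij by (intro diameter_le_cluster_radius) auto
  ultimately show ?thesis by linarith
qed

lemma max_radius_nonneg: "\<pi> \<in> assignments n k \<Longrightarrow> n > 0 \<Longrightarrow> 0 \<le> max_radius m n k X \<pi>"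
  using le_max_radius[of \<pi> n k 0 0 m X] eucl_norm_nonneg[of m "X 0 - X 0"] by linarith

text \<open>Greedy induction: the point farthest from \<open>T\<close> joins \<open>T\<close>. The
  covering radius only decreases, so old separations remain sufficient, and the new point is at
  least that radius away from all others. If the radius reaches 0 the growth stops, whence the final
  alternative.\<close>

lemma farthest_first:
  fixes D :: "nat \<Rightarrow> nat \<Rightarrow> real"
  assumes "n > 0" and pos: "\<And>i j. 0 \<le> D i j" and sym: "\<And>i j. D i j = D j i" and self: "\<And>i. D i i = 0"
  shows "\<exists>T \<rho>. T \<subseteq> {..<n} \<and> card T \<le> Suc k \<and> 0 \<le> \<rho> \<and> (\<forall>i<n. \<exists>j\<in>T. D i j \<le> \<rho>) \<and>
    (\<forall>a\<in>T. \<forall>b\<in>T. a \<noteq> b \<longrightarrow> \<rho> \<le> D a b) \<and> (\<rho> = 0 \<or> card T = Suc k)"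
proof (induction k)
  case 0
  define \<rho> where "\<rho> = Max ((\<lambda>i. D i 0) ` {..<n})"
  have "D i 0 \<le> \<rho>" if "i < n" for i
    using that by (simp add: \<rho>_def)
  moreover from this[OF \<open>n > 0\<close>] have "0 \<le> \<rho>"
    using pos order_trans by blast
  ultimately show ?case
    using \<open>n > 0\<close> by (intro exI[of _ "{0}"] exI[of _ \<rho>]) auto
next
  case (Suc k)
  then obtain T \<rho> where T: "T \<subseteq> {..<n}" "card T \<le> Suc k" "0 \<le> \<rho>"
    and cover: "\<And>i. i < n \<Longrightarrow> \<exists>j\<in>T. D i j \<le> \<rho>"
    and sep: "\<And>a b. a \<in> T \<Longrightarrow> b \<in> T \<Longrightarrow> a \<noteq> b \<Longrightarrow> \<rho> \<le> D a b"
    and full: "\<rho> = 0 \<or> card T = Suc k"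
    by metis
  have fin: "finite T" using T finite_subset by blast
  have ne: "T \<noteq> {}" using cover[OF \<open>n > 0\<close>] by blast
  define g where "g = (\<lambda>i. Min (D i ` T))"
  have g_le: "g i \<le> D i j" if "j \<in> T" for i j
    using that fin by (simp add: g_def)
  have g_att: "\<exists>j\<in>T. D i j = g i" for i
    using Min_in[of "D i ` T"] fin ne unfolding g_def by fastforce
  have g0: "0 \<le> g i" for i
    using g_att[of i] pos by metis
  define \<rho>' where "\<rho>' = Max (g ` {..<n})"
  have \<rho>'_ge: "g i \<le> \<rho>'" if "i < n" for i
    using that by (simp add: \<rho>'_def)
  obtain l where l: "l < n" "g l = \<rho>'"
    using Max_in[of "g ` {..<n}"] \<open>n > 0\<close> unfolding \<rho>'_def by fastforce
  have \<rho>': "0 \<le> \<rho>'" "\<rho>' \<le> \<rho>"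
  proof -
    obtain j where "j \<in> T" "D l j \<le> \<rho>" using cover[OF l(1)] by blast
    then show "\<rho>' \<le> \<rho>" using g_le[of j l] l(2) by linarith
  qed (use g0[of l] l(2) in linarith)
  have cover': "\<exists>j\<in>T. D i j \<le> \<rho>'" if "i < n" for i
  proof -
    obtain j where "j \<in> T" "D i j = g i" using g_att by blast
    then show ?thesis using \<rho>'_ge[OF that] by (intro bexI[of _ j]) simp_all
  qed
  show ?case
  proof (cases "\<rho>' = 0")
    case True
    show ?thesis
    proof (intro exI conjI allI impI ballI)
      show "\<exists>j\<in>T. D i j \<le> 0" if "i < n" for i
        using cover'[OF that] True by simp
    qed (use T pos in auto)
  next
    case False
    \<comment> \<open>The distance \<open>g\<close> to \<open>T\<close> is 0 on \<open>T\<close> but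
      positive at \<open>l\<close>.\<close>
    have lT: "l \<notin> T"
      using False g_le[of l l] \<rho>' l self by auto
    have lsep: "\<rho>' \<le> D l b" "\<rho>' \<le> D b l" if "b \<in> T" for b
      using g_le[OF that, of l] l sym[of b l] by simp_all
    \<comment> \<open>Here \<rho> \<ge> \<rho>' > 0, so the induction hypothesis makes
      \<open>T\<close> full.\<close>
    have card: "card (insert l T) = Suc (Suc k)"
      using False full \<rho>' lT fin by auto
    have sep': "\<rho>' \<le> D a b" if "a \<in> insert l T" "b \<in> insert l T" "a \<noteq> b" for a b
    proof (cases "a = l \<or> b = l")
      case True
      then show ?thesis using that lsep by blast
    next
      case False
      then have "\<rho> \<le> D a b" using that by (intro sep) auto
      then show ?thesis using \<rho>'(2) by simp
    qed
    show ?thesis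
    proof (intro exI conjI allI impI ballI)
      show "insert l T \<subseteq> {..<n}" using T l by simp
      show "card (insert l T) \<le> Suc (Suc k)" using card by simp
      show "0 \<le> \<rho>'" by (rule \<rho>'(1))
      show "\<exists>j\<in>insert l T. D i j \<le> \<rho>'" if "i < n" for i
        using cover'[OF that] by blast
      show "\<rho>' \<le> D a b" if "a \<in> insert l T" "b \<in> insert l T" "a \<noteq> b" for a b
        by (rule sep'[OF that])
      show "\<rho>' = 0 \<or> card (insert l T) = Suc (Suc k)" using card by blast
    qed
  qed
qed

text \<open>With \<open>\<rho>\<close> the covering radius of \<open>T\<close>, two points of \<open>T\<close> share a cluster, so the image has
  radius of order at least \<open>\<rho>\<close>; and passing from the points of a cluster to their representatives in
  \<open>T\<close> costs only \<open>O(\<rho>)\<close> before and \<open>O(L \<rho>)\<close> after the map.\<close>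

lemma diameter_le_image_radius:
  fixes X Y :: "nat \<Rightarrow> nat \<Rightarrow> real"
  assumes T: "T \<subseteq> {..<n}" and cover: "\<And>i. i < n \<Longrightarrow> \<exists>j\<in>T. eucl_norm d (X i - X j) \<le> \<rho>"
    and sep: "\<And>a b. a \<in> T \<Longrightarrow> b \<in> T \<Longrightarrow> a \<noteq> b \<Longrightarrow> \<rho> \<le> eucl_norm d (X a - X b)"
    and full: "\<rho> = 0 \<or> card T = Suc k"
    and c: "c > 0" and L: "L \<ge> 0"
    and up: "\<And>i j. i < n \<Longrightarrow> j < n \<Longrightarrow> eucl_norm t (Y i - Y j) \<le> L * eucl_norm d (X i - X j)"
    and low: "\<And>a b. a \<in> T \<Longrightarrow> b \<in> T \<Longrightarrow> c * eucl_norm d (X a - X b) \<le> eucl_norm t (Y a - Y b)"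
    and \<pi>: "\<pi> \<in> assignments n k" and pq: "p < n" "q < n" "\<pi> p = \<pi> q"
  shows "eucl_norm d (X p - X q) \<le> 2 / c * (3 + 2 * L / c) * max_radius t n k Y \<pi>"
proof -
  let ?D = "\<lambda>i j. eucl_norm d (X i - X j)"
  let ?D' = "\<lambda>i j. eucl_norm t (Y i - Y j)"
  define r where "r = max_radius t n k Y \<pi>"
  have le_r: "?D' i j \<le> 2 * r" if "i < n" "j < n" "\<pi> i = \<pi> j" for i j
    unfolding r_def by (rule le_max_radius[OF \<pi> that])
  have r0: "0 \<le> r"
    unfolding r_def using pq(1) by (intro max_radius_nonneg[OF \<pi>]) simp
  have \<rho>r: "c * \<rho> \<le> 2 * r"
  proof (cases "\<rho> = 0")
    case False
    then have "card T = Suc k" using full by simp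
    moreover have "\<pi> ` T \<subseteq> {..<k}"
      using \<pi> T by (auto simp: assignments_def)
    then have "card (\<pi> ` T) \<le> k"
      using card_mono[of "{..<k}"] by fastforce
    ultimately have "\<not> inj_on \<pi> T"
      using card_image by fastforce
    then obtain a b where ab: "a \<in> T" "b \<in> T" "a \<noteq> b" "\<pi> a = \<pi> b"
      by (auto simp: inj_on_def)
    have "c * \<rho> \<le> c * ?D a b"
      using c sep ab by (intro mult_left_mono) auto
    also have "\<dots> \<le> ?D' a b"
      using low ab by blast
    also have "\<dots> \<le> 2 * r"
      using ab T by (intro le_r) auto
    finally show ?thesis .
  qed (use r0 in simp)
  obtain a where a: "a \<in> T" "?D p a \<le> \<rho>" using cover[OF pq(1)] by blast
  obtain b where b: "b \<in> T" "?D q b \<le> \<rho>" using cover[OF pq(2)] by blast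
  have abn: "a < n" "b < n" using a b T by auto
  have 1: "?D p q \<le> ?D p a + ?D a b + ?D q b"
    using eucl_norm_diff_triangle[of d "X p" "X q" "X a"] eucl_norm_diff_triangle[of d "X a" "X q" "X b"]
    by (simp add: eucl_norm_diff_commute[of d "X b" "X q"])
  have 2: "?D' a b \<le> ?D' p a + ?D' p q + ?D' q b"
    using eucl_norm_diff_triangle[of t "Y a" "Y b" "Y p"] eucl_norm_diff_triangle[of t "Y p" "Y b" "Y q"]
    by (simp add: eucl_norm_diff_commute[of t "Y a" "Y p"])
  have 3: "?D' p a \<le> L * \<rho>"
    using up[OF pq(1) abn(1)] mult_left_mono[OF a(2) L] by linarith
  have 4: "?D' q b \<le> L * \<rho>"
    using up[OF pq(2) abn(2)] mult_left_mono[OF b(2) L] by linarith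
  have "c * ?D a b \<le> 2 * (L * \<rho>) + 2 * r"
    using low[OF a(1) b(1)] 2 3 4 le_r[OF pq] by linarith
  then have 5: "?D a b \<le> 2 * (L * \<rho>) / c + 2 * r / c"
    using c by (simp add: field_simps)
  have 6: "\<rho> \<le> 2 * r / c"
    using \<rho>r c by (simp add: field_simps)
  have "L * \<rho> / c \<le> L * (2 * r / c) / c"
    using 6 L c by (intro divide_right_mono mult_left_mono) auto
  \<comment> \<open>Moving \<open>p\<close> and \<open>q\<close> to representatives costs 2 \<rho>
    before the map and 2 L \<rho> / c after it, and their images lie within 2 r. Substituting \<rho>
    \<le> 2 r / c yields the factor.\<close>
  then have "?D p q \<le> 2 * (2 * r / c) + 2 * (L * (2 * r / c) / c) + 2 * r / c"
    using 1 5 6 a(2) b(2) by linarith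
  also have "\<dots> = 2 / c * (3 + 2 * L / c) * r"
    using c by (simp add: field_simps)
  finally show ?thesis by (simp add: r_def)
qed

subsection \<open>Optimal values\<close>

lemma finite_feasible: "finite {\<pi>. feasible AC n k \<pi>}"
  by (rule finite_subset[of _ "assignments n k"])
     (auto simp: feasible_def assignments_def intro!: finite_PiE)

lemma OPT_le: "feasible AC n k \<pi> \<Longrightarrow> OPT m n k AC X \<le> max_radius m n k X \<pi>"
  unfolding OPT_def by (intro Min_le) (auto simp: finite_feasible)

lemma OPT_attained:
  assumes "\<exists>\<pi>. feasible AC n k \<pi>"
  obtains \<pi> where "feasible AC n k \<pi>" "OPT m n k AC X = max_radius m n k X \<pi>"
proof -
  have "OPT m n k AC X \<in> max_radius m n k X ` {\<pi>. feasible AC n k \<pi>}"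
    unfolding OPT_def using assms by (intro Min_in) (auto simp: finite_feasible)
  then show ?thesis using that by blast
qed

text \<open>The radius bounds hold for every assignment, so an optimum on one side competes on the
  other under any constraint. Some feasible assignment must exist for \<open>Min\<close> to be
  attained.\<close>

lemma OPT_distortion:
  assumes low: "\<And>\<pi>. \<pi> \<in> assignments n k \<Longrightarrow> max_radius d n k X \<pi> \<le> max_radius t n k Y \<pi>"
    and up: "\<And>\<pi>. \<pi> \<in> assignments n k \<Longrightarrow> max_radius t n k Y \<pi> \<le> K * max_radius d n k X \<pi>"
    and ex: "\<exists>\<pi>. feasible AC n k \<pi>"
  shows "OPT d n k AC X \<le> OPT t n k AC Y" "OPT t n k AC Y \<le> K * OPT d n k AC X"
    "\<beta> \<ge> 0 \<Longrightarrow> approx_sol \<beta> t n k AC Y \<pi> \<Longrightarrow> approx_sol (\<beta> * K) d n k AC X \<pi>"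
proof -
  show "OPT d n k AC X \<le> OPT t n k AC Y"
    using OPT_attained[OF ex, of t Y] OPT_le low feasible_def by (metis order_trans)
  show *: "OPT t n k AC Y \<le> K * OPT d n k AC X"
    using OPT_attained[OF ex, of d X] OPT_le up feasible_def by (metis order_trans)
  assume "\<beta> \<ge> 0" and \<pi>: "approx_sol \<beta> t n k AC Y \<pi>"
  have "max_radius d n k X \<pi> \<le> max_radius t n k Y \<pi>"
    using \<pi> low by (auto simp: approx_sol_def feasible_def)
  also have "\<dots> \<le> \<beta> * OPT t n k AC Y"
    using \<pi> by (simp add: approx_sol_def)
  also have "\<dots> \<le> \<beta> * (K * OPT d n k AC X)"
    using * \<open>\<beta> \<ge> 0\<close> by (rule mult_left_mono)
  finally show "approx_sol (\<beta> * K) d n k AC X \<pi>"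
    using \<pi> by (simp add: approx_sol_def mult.assoc)
qed

subsection \<open>Distortion of the maximum radius\<close>


text \<open>Scaling by \<open>s\<close> turns L and c into sL and sc and leaves their ratio
  unchanged; \<open>s\<close> is chosen so that the contraction factor of
  \<open>diameter_le_image_radius\<close> becomes exactly 1. The expansion factor is then 2sL, the 2
  coming from diameter against radius.\<close>

lemma max_radius_distortion:
  assumes k: "k \<ge> 1" and n: "n > 0" and L: "L \<ge> 0" and c: "c > 0"
    and T: "T \<subseteq> {..<n}" and cover: "\<And>i. i < n \<Longrightarrow> \<exists>j\<in>T. eucl_norm d (X i - X j) \<le> \<rho>"
    and sep: "\<And>a b. a \<in> T \<Longrightarrow> b \<in> T \<Longrightarrow> a \<noteq> b \<Longrightarrow> \<rho> \<le> eucl_norm d (X a - X b)"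
    and full: "\<rho> = 0 \<or> card T = Suc k"
    and up: "\<And>x. eucl_norm t (lin_apply t d \<epsilon> x) \<le> L * eucl_norm d x"
    and low: "\<And>a b. a \<in> T \<Longrightarrow> b \<in> T \<Longrightarrow>
      c * eucl_norm d (X a - X b) \<le> eucl_norm t (lin_apply t d \<epsilon> (X a - X b))"
    and s: "s = 2 / c * (3 + 2 * L / c)" and \<pi>: "\<pi> \<in> assignments n k"
  defines "Y \<equiv> map_points t d (\<lambda>i j. s * \<epsilon> i j) X"
  shows "max_radius d n k X \<pi> \<le> max_radius t n k Y \<pi>"
    and "max_radius t n k Y \<pi> \<le> 2 * (s * L) * max_radius d n k X \<pi>"
proof -
  have s0: "s > 0"
    using c L unfolding s by (intro mult_pos_pos) (auto intro: add_pos_nonneg)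
  have Y: "eucl_norm t (Y i - Y j) = s * eucl_norm t (lin_apply t d \<epsilon> (X i - X j))" for i j
  proof -
    have "Y i - Y j = (\<lambda>l. s * lin_apply t d \<epsilon> (X i - X j) l)"
      by (simp add: Y_def map_points_def lin_apply_scale_matrix lin_apply_diff fun_eq_iff
        right_diff_distrib)
    then show ?thesis using s0 by (simp add: eucl_norm_scale)
  qed
  have upY: "eucl_norm t (Y i - Y j) \<le> s * L * eucl_norm d (X i - X j)" for i j
    using up[of "X i - X j"] s0 by (simp add: Y)
  have lowY: "s * c * eucl_norm d (X a - X b) \<le> eucl_norm t (Y a - Y b)" if "a \<in> T" "b \<in> T" for a b
    using low[OF that] s0 by (simp add: Y)
  have one: "2 / (s * c) * (3 + 2 * (s * L) / (s * c)) = 1"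
  proof -
    have "2 / (s * c) * (3 + 2 * (s * L) / (s * c)) = (2 / c * (3 + 2 * L / c)) / s"
      using s0 by simp
    also have "\<dots> = s / s"
      by (simp only: s[symmetric])
    also have "s / s = 1" using s0 by simp
    finally show ?thesis .
  qed
  have r0: "0 \<le> max_radius t n k Y \<pi>" "0 \<le> max_radius d n k X \<pi>"
    by (rule max_radius_nonneg[OF \<pi> n])+
  show "max_radius d n k X \<pi> \<le> max_radius t n k Y \<pi>"
  proof (rule max_radius_le[OF k r0(1)])
    fix p q assume pq: "p < n" "q < n" "\<pi> p = \<pi> q"
    have "eucl_norm d (X p - X q) \<le> 2 / (s * c) * (3 + 2 * (s * L) / (s * c)) * max_radius t n k Y \<pi>"
      using s0 c L
      by (intro diameter_le_image_radius[OF T cover sep full _ _ upY lowY \<pi> pq]) auto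
    then show "eucl_norm d (X p - X q) \<le> max_radius t n k Y \<pi>"
      by (simp only: one mult_1)
  qed
  show "max_radius t n k Y \<pi> \<le> 2 * (s * L) * max_radius d n k X \<pi>"
  proof (rule max_radius_le[OF k])
    show "0 \<le> 2 * (s * L) * max_radius d n k X \<pi>"
      using s0 L r0 by simp
    fix p q assume pq: "p < n" "q < n" "\<pi> p = \<pi> q"
    have "eucl_norm t (Y p - Y q) \<le> s * L * eucl_norm d (X p - X q)"
      by (rule upY)
    also have "\<dots> \<le> s * L * (2 * max_radius d n k X \<pi>)"
      using s0 L le_max_radius[OF \<pi> pq] by (intro mult_left_mono) auto
    finally show "eucl_norm t (Y p - Y q) \<le> 2 * (s * L) * max_radius d n k X \<pi>"
      by (simp add: mult_ac)
  qed
qed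

lemma random_map_distortion:
  fixes d n k :: nat and \<alpha> :: real
  assumes "d > 1" "\<alpha> > 1" "1 \<le> k" "k \<le> n"
  shows "\<exists>(t::nat) (M :: (nat \<Rightarrow> nat \<Rightarrow> real) measure).
       real t \<le> 121 * max 1 (real d / \<alpha> + ln (real k)) \<and> prob_space M \<and>
       (\<forall>P :: nat \<Rightarrow> nat \<Rightarrow> real. \<exists>E \<in> sets M. measure M E \<ge> 2/3 \<and>
          (\<forall>G \<in> E. \<forall>\<pi> \<in> assignments n k.
             max_radius d n k P \<pi> \<le> max_radius t n k (map_points t d G P) \<pi> \<and>
             max_radius t n k (map_points t d G P) \<pi> \<le> 8060 * \<alpha> * max_radius d n k P \<pi>))"
proof -
  define m where "m = max 1 (real d / \<alpha> + ln (real k))"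
  have lnk: "0 \<le> ln (real k)"
    using assms by (intro ln_ge_zero) auto
  have m: "1 \<le> m" "real d / \<alpha> \<le> m" "ln (real k) \<le> m"
    using lnk assms by (auto simp: m_def le_max_iff_disj)
  \<comment> \<open>The failure bound for \<open>V\<close> needs t/20 \<ge> 4 + 2 ln k. Since m
    dominates both 1 and ln k, 120 m rows are enough, and m \<ge> 1 absorbs the rounding into 121
    m.\<close>
  define t where "t = nat \<lceil>120 * m\<rceil>"
  have t: "120 * m \<le> real t" "real t \<le> 121 * m"
    using m(1) unfolding t_def by linarith+
  have t0: "t > 0" using t(1) m(1) by linarith
  define L where "L = 4 * sqrt (6 * (real d + real t + 1))"
  define c where "c = sqrt (3/10 * real t)"
  define s where "s = 2 / c * (3 + 2 * L / c)"
  have L0: "L \<ge> 0" and c0: "c > 0"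
    using t0 by (auto simp: L_def c_def)
  define f where "f = (\<lambda>\<epsilon> :: nat \<Rightarrow> nat \<Rightarrow> real. \<lambda>i j. s * \<epsilon> i j)"
  let ?\<Omega> = "sign_matrices t d"
  have ne: "?\<Omega> \<noteq> {}"
    using card_sign_matrices[of t d] by fastforce
  \<comment> \<open>A discrete distribution, fixed before the point set \<open>P\<close>; every set
    of matrices is an event.\<close>
  define M where "M = measure_pmf (map_pmf f (pmf_of_set ?\<Omega>))"
  have ratio: "L / c \<le> 31 * sqrt \<alpha>"
  proof -
    have "real d \<le> \<alpha> * real t"
    proof -
      have "real d \<le> \<alpha> * m" using m(2) assms by (simp add: field_simps)
      also have "\<dots> \<le> \<alpha> * real t" using t(1) m(1) assms by (intro mult_left_mono) auto
      finally show ?thesis .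
    qed
    moreover have "real t \<le> \<alpha> * real t"
      using assms by (simp add: mult_le_cancel_right1)
    ultimately have "real d + real t + 1 \<le> 3 * (\<alpha> * real t)"
      using t(1) m(1) by linarith
    \<comment> \<open>The constant 31 comes from 96 * 3 = 288 \<le> 288.3 = 31^2 * 3/10.\<close>
    then have "96 * (real d + real t + 1) \<le> 961 * \<alpha> * (3/10 * real t)"
      using assms t0 by (simp add: field_simps)
    then have "L\<^sup>2 \<le> (31 * sqrt \<alpha> * c)\<^sup>2"
      using assms t0 by (simp add: L_def c_def power_mult_distrib)
    then have "L \<le> 31 * sqrt \<alpha> * c"
      by (rule power2_le_imp_le) (use c0 assms in auto)
    then show ?thesis using c0 by (simp add: field_simps)
  qed
  \<comment> \<open>8060 = 4 * 31 * (3 + 2 * 31), where 3 \<le> 3 sqrt \<alpha> makes the bound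
    homogeneous in \<alpha>.\<close>
  have K: "2 * (s * L) \<le> 8060 * \<alpha>"
  proof -
    have "1 \<le> sqrt \<alpha>" using assms by simp
    have "2 * (s * L) = 4 * (L / c) * (3 + 2 * (L / c))"
      by (simp add: s_def)
    also have "\<dots> \<le> 4 * (31 * sqrt \<alpha>) * (3 * sqrt \<alpha> + 2 * (31 * sqrt \<alpha>))"
      using ratio L0 c0 \<open>1 \<le> sqrt \<alpha>\<close> assms by (intro mult_mono add_mono) auto
    also have "\<dots> = 8060 * (sqrt \<alpha> * sqrt \<alpha>)"
      by (simp add: algebra_simps)
    finally show ?thesis using assms by simp
  qed
  have main: "\<exists>E \<in> sets M. measure M E \<ge> 2/3 \<and>
      (\<forall>G \<in> E. \<forall>\<pi> \<in> assignments n k.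
         max_radius d n k P \<pi> \<le> max_radius t n k (map_points t d G P) \<pi> \<and>
         max_radius t n k (map_points t d G P) \<pi> \<le> 8060 * \<alpha> * max_radius d n k P \<pi>)"
    for P :: "nat \<Rightarrow> nat \<Rightarrow> real"
  proof -
    have "\<exists>T \<rho>. T \<subseteq> {..<n} \<and> card T \<le> Suc k \<and> 0 \<le> \<rho> \<and> (\<forall>i<n. \<exists>j\<in>T. eucl_norm d (P i - P j) \<le> \<rho>) \<and>
      (\<forall>a\<in>T. \<forall>b\<in>T. a \<noteq> b \<longrightarrow> \<rho> \<le> eucl_norm d (P a - P b)) \<and> (\<rho> = 0 \<or> card T = Suc k)"
      using assms
      by (intro farthest_first eucl_norm_nonneg eucl_norm_diff_commute) (auto simp: eucl_norm_def)
    then obtain T \<rho> where T: "T \<subseteq> {..<n}" "card T \<le> Suc k"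
      and cover: "\<And>i. i < n \<Longrightarrow> \<exists>j\<in>T. eucl_norm d (P i - P j) \<le> \<rho>"
      and sep: "\<And>a b. a \<in> T \<Longrightarrow> b \<in> T \<Longrightarrow> a \<noteq> b \<Longrightarrow> \<rho> \<le> eucl_norm d (P a - P b)"
      and full: "\<rho> = 0 \<or> card T = Suc k"
      by blast
    have finT: "finite T" using T finite_subset by blast
    define V where "V = (\<lambda>(a, b). P a - P b) ` (T \<times> T)"
    have finV: "finite V" using finT by (simp add: V_def)
    have "card V \<le> card (T \<times> T)"
      unfolding V_def using finT by (intro card_image_le) auto
    \<comment> \<open>Since k \<ge> 1, the k + 1 points of \<open>T\<close> number at most
      2k.\<close>
    also have "\<dots> \<le> (2 * k) * (2 * k)"
      unfolding card_cartesian_product using T(2) assms by (intro mult_le_mono) auto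
    finally have "card V \<le> 4 * k\<^sup>2"
      by (simp add: power2_eq_square)
    then have cardV: "real (card V) \<le> 4 * (real k)\<^sup>2"
      by (metis of_nat_le_iff of_nat_mult of_nat_numeral of_nat_power)
    have "16 \<le> exp (4::real)"
    proof -
      have "(2::real) ^ 4 \<le> exp 1 ^ 4"
        using exp_ge_add_one_self[of 1] by (intro power_mono) auto
      then show ?thesis by (simp flip: exp_of_nat_mult)
    qed
    then have "16 * (real k)\<^sup>2 \<le> exp 4 * (exp (ln (real k)))\<^sup>2"
      using assms by simp
    also have "\<dots> = exp (4 + 2 * ln (real k))"
      by (simp add: exp_add exp_double)
    also have "\<dots> \<le> exp (real t / 20)"
      using t(1) m by simp
    finally have "4 * (real k)\<^sup>2 * exp (- real t / 20) \<le> 1/4"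
      by (simp add: exp_minus field_simps)
    then have V: "real (card V) * exp (- real t / 20) \<le> 1/4"
      by (rule order_trans[OF mult_right_mono[OF cardV exp_ge_zero]])
    define Good where "Good = {\<epsilon> \<in> ?\<Omega>.
      (\<forall>x. eucl_norm t (lin_apply t d \<epsilon> x) \<le> L * eucl_norm d x) \<and>
      (\<forall>v\<in>V. c * eucl_norm d v \<le> eucl_norm t (lin_apply t d \<epsilon> v))}"
    have cardGood: "2/3 * real (card ?\<Omega>) \<le> real (card Good)"
      unfolding Good_def L_def c_def
      using assms t0 by (intro card_good_sign_matrices finV V) auto
    have "2/3 \<le> measure (measure_pmf (pmf_of_set ?\<Omega>)) Good"
    proof -
      have "?\<Omega> \<inter> Good = Good" by (auto simp: Good_def)
      moreover have "real (card ?\<Omega>) > 0" using ne by (simp add: card_gt_0_iff)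
      ultimately show ?thesis
        using cardGood ne by (simp add: measure_pmf_of_set field_simps)
    qed
    also have "\<dots> \<le> measure (measure_pmf (pmf_of_set ?\<Omega>)) (f -` (f ` Good))"
      by (intro measure_pmf.finite_measure_mono) auto
    also have "\<dots> = measure M (f ` Good)"
      by (simp add: M_def)
    finally have prob: "2/3 \<le> measure M (f ` Good)" .
    have "max_radius d n k P \<pi> \<le> max_radius t n k (map_points t d (f \<epsilon>) P) \<pi>"
      "max_radius t n k (map_points t d (f \<epsilon>) P) \<pi> \<le> 8060 * \<alpha> * max_radius d n k P \<pi>"
      if \<epsilon>: "\<epsilon> \<in> Good" and \<pi>: "\<pi> \<in> assignments n k" for \<epsilon> \<pi>
    proof -
      have n0: "n > 0" using assms by simp
      have up: "eucl_norm t (lin_apply t d \<epsilon> x) \<le> L * eucl_norm d x" for x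
        using \<epsilon> by (simp add: Good_def)
      have low: "c * eucl_norm d (P a - P b) \<le> eucl_norm t (lin_apply t d \<epsilon> (P a - P b))"
        if "a \<in> T" "b \<in> T" for a b
        using \<epsilon> that by (auto simp: Good_def V_def)
      note dist = max_radius_distortion[OF assms(3) n0 L0 c0 T(1) cover sep full up low s_def \<pi>]
      show "max_radius d n k P \<pi> \<le> max_radius t n k (map_points t d (f \<epsilon>) P) \<pi>"
        unfolding f_def by (rule dist(1))
      have "0 \<le> max_radius d n k P \<pi>"
        by (rule max_radius_nonneg[OF \<pi> n0])
      then have "2 * (s * L) * max_radius d n k P \<pi> \<le> 8060 * \<alpha> * max_radius d n k P \<pi>"
        by (rule mult_right_mono[OF K])
      moreover have "max_radius t n k (map_points t d (f \<epsilon>) P) \<pi> \<le> 2 * (s * L) * max_radius d n k P \<pi>"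
        unfolding f_def by (rule dist(2))
      ultimately show "max_radius t n k (map_points t d (f \<epsilon>) P) \<pi> \<le> 8060 * \<alpha> * max_radius d n k P \<pi>"
        by linarith
    qed
    then show ?thesis
      using prob by (intro bexI[of _ "f ` Good"]) (auto simp: M_def)
  qed
  show ?thesis
    using t(2) main unfolding m_def
    by (intro exI[of _ t] exI[of _ M] conjI allI) (auto simp: M_def measure_pmf.prob_space_axioms)
qed

theorem theorem4p3:
  fixes \<beta> :: real
  assumes "\<beta> \<ge> 1"
  shows "\<exists>C>0. \<exists>A>0. \<forall>(d::nat) (\<alpha>::real) (k::nat) (n::nat).
    d > 1 \<longrightarrow> \<alpha> > 1 \<longrightarrow> 1 \<le> k \<longrightarrow> k \<le> n \<longrightarrow>
    (\<exists>(t::nat) (M :: (nat \<Rightarrow> nat \<Rightarrow> real) measure).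
       real t \<le> C * max 1 (real d / \<alpha> + ln (real k)) \<and>
       prob_space M \<and>
       (\<forall>P :: nat \<Rightarrow> nat \<Rightarrow> real.
          \<exists>E \<in> sets M. measure M E \<ge> 2/3 \<and>
            (\<forall>G \<in> E. \<forall>AC :: (nat \<Rightarrow> nat) \<Rightarrow> bool.
               (\<exists>\<pi>. feasible AC n k \<pi>) \<longrightarrow>
               (OPT d n k AC P \<le> OPT t n k AC (map_points t d G P) \<and>
                OPT t n k AC (map_points t d G P) \<le> A * \<alpha> * OPT d n k AC P) \<and>
               (\<forall>\<pi>. feasible AC n k \<pi> \<longrightarrow>
                  approx_sol \<beta> t n k AC (map_points t d G P) \<pi> \<longrightarrow>
                  approx_sol (A * \<alpha>) d n k AC P \<pi>))))"
proof (rule exI[of _ 121], intro conjI, simp, rule exI[of _ "8060 * \<beta>"], intro conjI allI impI)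
  \<comment> \<open>The factor \<beta> is the loss in the claim on approximate solutions; the claim
    on optima holds with 8060 and is weakened to share the constant.\<close>
  show "0 < 8060 * \<beta>" using assms by simp
  fix d n k :: nat and \<alpha> :: real
  assume h: "d > 1" "\<alpha> > 1" "1 \<le> k" "k \<le> n"
  obtain t and M :: "(nat \<Rightarrow> nat \<Rightarrow> real) measure" where
    tM: "real t \<le> 121 * max 1 (real d / \<alpha> + ln (real k))" "prob_space M"
    and main: "\<And>P :: nat \<Rightarrow> nat \<Rightarrow> real. \<exists>E \<in> sets M. measure M E \<ge> 2/3 \<and>
          (\<forall>G \<in> E. \<forall>\<pi> \<in> assignments n k.
             max_radius d n k P \<pi> \<le> max_radius t n k (map_points t d G P) \<pi> \<and>
             max_radius t n k (map_points t d G P) \<pi> \<le> 8060 * \<alpha> * max_radius d n k P \<pi>)"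
    using random_map_distortion[OF h] by blast
  show "\<exists>t M. real t \<le> 121 * max 1 (real d / \<alpha> + ln (real k)) \<and> prob_space M \<and>
       (\<forall>P :: nat \<Rightarrow> nat \<Rightarrow> real.
          \<exists>E \<in> sets M. measure M E \<ge> 2/3 \<and>
            (\<forall>G \<in> E. \<forall>AC :: (nat \<Rightarrow> nat) \<Rightarrow> bool.
               (\<exists>\<pi>. feasible AC n k \<pi>) \<longrightarrow>
               (OPT d n k AC P \<le> OPT t n k AC (map_points t d G P) \<and>
                OPT t n k AC (map_points t d G P) \<le> 8060 * \<beta> * \<alpha> * OPT d n k AC P) \<and>
               (\<forall>\<pi>. feasible AC n k \<pi> \<longrightarrow>
                  approx_sol \<beta> t n k AC (map_points t d G P) \<pi> \<longrightarrow>
                  approx_sol (8060 * \<beta> * \<alpha>) d n k AC P \<pi>)))"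
  proof (rule exI[of _ t], rule exI[of _ M], intro conjI allI tM)
    fix P :: "nat \<Rightarrow> nat \<Rightarrow> real"
    obtain E where E: "E \<in> sets M" "measure M E \<ge> 2/3"
      and low: "\<And>G \<pi>. G \<in> E \<Longrightarrow> \<pi> \<in> assignments n k \<Longrightarrow>
        max_radius d n k P \<pi> \<le> max_radius t n k (map_points t d G P) \<pi>"
      and up: "\<And>G \<pi>. G \<in> E \<Longrightarrow> \<pi> \<in> assignments n k \<Longrightarrow>
        max_radius t n k (map_points t d G P) \<pi> \<le> 8060 * \<alpha> * max_radius d n k P \<pi>"
      using main[of P] by blast
    show "\<exists>E \<in> sets M. measure M E \<ge> 2/3 \<and>
            (\<forall>G \<in> E. \<forall>AC :: (nat \<Rightarrow> nat) \<Rightarrow> bool.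
               (\<exists>\<pi>. feasible AC n k \<pi>) \<longrightarrow>
               (OPT d n k AC P \<le> OPT t n k AC (map_points t d G P) \<and>
                OPT t n k AC (map_points t d G P) \<le> 8060 * \<beta> * \<alpha> * OPT d n k AC P) \<and>
               (\<forall>\<pi>. feasible AC n k \<pi> \<longrightarrow>
                  approx_sol \<beta> t n k AC (map_points t d G P) \<pi> \<longrightarrow>
                  approx_sol (8060 * \<beta> * \<alpha>) d n k AC P \<pi>))"
    proof (rule bexI[OF _ E(1)], intro conjI ballI allI impI E(2))
      fix G and AC :: "(nat \<Rightarrow> nat) \<Rightarrow> bool"
      assume G: "G \<in> E" and ex: "\<exists>\<pi>. feasible AC n k \<pi>"
      let ?Y = "map_points t d G P"
      note dist = OPT_distortion[OF low[OF G] up[OF G] ex]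
      show "OPT d n k AC P \<le> OPT t n k AC ?Y"
        by (rule dist(1))
      \<comment> \<open>Enlarging the constant by \<beta> \<ge> 1 is sound only because the optimum
        is nonnegative.\<close>
      have "0 \<le> 8060 * \<alpha> * OPT d n k AC P"
      proof -
        obtain \<pi> where "feasible AC n k \<pi>" "OPT d n k AC P = max_radius d n k P \<pi>"
          using OPT_attained[OF ex] by blast
        then show ?thesis
          using max_radius_nonneg[of \<pi> n k d P] h by (simp add: feasible_def)
      qed
      then have "1 * (8060 * \<alpha> * OPT d n k AC P) \<le> \<beta> * (8060 * \<alpha> * OPT d n k AC P)"
        using assms by (intro mult_right_mono) auto
      then show "OPT t n k AC ?Y \<le> 8060 * \<beta> * \<alpha> * OPT d n k AC P"
        using dist(2) by (simp add: mult_ac)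
      fix \<pi> assume "approx_sol \<beta> t n k AC ?Y \<pi>"
      then have "approx_sol (\<beta> * (8060 * \<alpha>)) d n k AC P \<pi>"
        using assms by (intro dist(3)) auto
      then show "approx_sol (8060 * \<beta> * \<alpha>) d n k AC P \<pi>"
        by (simp add: mult_ac)
    qed
  qed
qed

end
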